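(* The monoid $M_2(K^{-\infty})$ of $2\times 2$ matrices over the max-plus semiring $K^{-\infty}=\mathbb{N}\cup\{-\infty\}$ is generated by the matrices $$X_i=\begin{pmatrix} i & 0\\ 0 & -\infty\end{pmatrix},\qquad Y=\begin{pmatrix} 1 & -\infty\\ -\infty & 0\end{pmatrix},\qquad Z=\begin{pmatrix} -\infty & -\infty\\ -\infty & 0\end{pmatrix},\qquad W_{jk}=\begin{pmatrix} 0 & j\\ k & 0\end{pmatrix},$$ where $i\in\mathbb{N}\cup\{-\infty\}$ and $j,k\in\mathbb{N}$ are such that $0<j\leq k$.
   Context: $\mathbb{N}=\{0,1,2,\ldots\}$. The max-plus semiring $K^{-\infty}$ is the set $\mathbb{N}\cup\{-\infty\}$ with operations $\oplus=\max$ (where $-\infty$ is the smallest element) and $\otimes=+$, where $x\otimes(-\infty)=(-\infty)\otimes x=-\infty$ for all $x\in\mathbb{N}\cup\{-\infty\}$. Its multiplicative identity (one) is the number $0$ and its additive identity (zero) is $-\infty$. $M_2(K^{-\infty})$ is the monoid of all $2\times 2$ matrices with entries in $K^{-\infty}$ under matrix multiplication with respect to $\oplus$ and $\otimes$, i.e. $(AB)_{pq}=(A_{p1}\otimes B_{1q})\oplus(A_{p2}\otimes B_{2q})$; its identity is $\begin{pmatrix} 0&-\infty\\ -\infty&0\end{pmatrix}$. The entries $0,1,i,j,k$ in the matrices of the claim denote the corresponding natural numbers (or $-\infty$), not the zero and one of the semiring. *)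

theory Defs
  imports "HOL-Analysis.Cartesian_Space" "HOL-Algebra.Group"
begin

datatype maxplus = NegInf | Fin nat

instantiation maxplus :: "{linorder, order_bot}"
begin

fun less_eq_maxplus :: "maxplus \<Rightarrow> maxplus \<Rightarrow> bool" where
  "less_eq_maxplus NegInf y \<longleftrightarrow> True"
| "less_eq_maxplus (Fin m) NegInf \<longleftrightarrow> False"
| "less_eq_maxplus (Fin m) (Fin n) \<longleftrightarrow> m \<le> n"

definition less_maxplus :: "maxplus \<Rightarrow> maxplus \<Rightarrow> bool" where
  "less_maxplus x y \<longleftrightarrow> x \<le> y \<and> \<not> y \<le> x"

definition bot_maxplus :: maxplus where
  "bot_maxplus = NegInf"

instance
proof
  fix x y z :: maxplus
  show "x < y \<longleftrightarrow> x \<le> y \<and> \<not> y \<le> x"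
    by (rule less_maxplus_def)
  show "x \<le> x"
    by (cases x) auto
  show "x \<le> z" if "x \<le> y" "y \<le> z"
    using that by (cases x; cases y; cases z) auto
  show "x = y" if "x \<le> y" "y \<le> x"
    using that by (cases x; cases y) auto
  show "x \<le> y \<or> y \<le> x"
    by (cases x; cases y) auto
  show "bot \<le> x"
    by (simp add: bot_maxplus_def)
qed

end

instantiation maxplus :: comm_semiring_1
begin

definition zero_maxplus :: maxplus where
  "zero_maxplus = NegInf"

definition one_maxplus :: maxplus where
  "one_maxplus = Fin 0"

definition plus_maxplus :: "maxplus \<Rightarrow> maxplus \<Rightarrow> maxplus" where
  "plus_maxplus x y = max x y"

fun times_maxplus :: "maxplus \<Rightarrow> maxplus \<Rightarrow> maxplus" where
  "times_maxplus NegInf y = NegInf"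
| "times_maxplus (Fin m) NegInf = NegInf"
| "times_maxplus (Fin m) (Fin n) = Fin (m + n)"

instance
proof
  fix a b c :: maxplus
  show "a + b + c = a + (b + c)"
    by (simp add: plus_maxplus_def max.assoc)
  show "a + b = b + a"
    by (simp add: plus_maxplus_def max.commute)
  show "0 + a = a"
    by (simp add: plus_maxplus_def zero_maxplus_def max_def)
  show "a * b * c = a * (b * c)"
    by (cases a; cases b; cases c) auto
  show "a * b = b * a"
    by (cases a; cases b) auto
  show "1 * a = a"
    by (cases a) (auto simp: one_maxplus_def)
  show "(a + b) * c = a * c + b * c"
    by (cases a; cases b; cases c) (auto simp: plus_maxplus_def max_def)
  show "0 * a = 0" "a * 0 = 0"
    by (cases a; simp add: zero_maxplus_def)+
  show "(0::maxplus) \<noteq> 1"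
    by (simp add: zero_maxplus_def one_maxplus_def)
qed

end

text \<open>
  Here \<open>+\<close> and \<open>*\<close> are the semiring operations max and plus, so \<^term>\<open>0 :: maxplus\<close> is
  minus infinity and \<^term>\<open>1 :: maxplus\<close> is the natural number zero. The natural number \<open>n\<close>
  as an element of the semiring is always written \<^term>\<open>Fin n\<close>.
\<close>

definition M2 :: "(maxplus^2^2) monoid" where
  "M2 = \<lparr>carrier = UNIV, mult = (**), one = mat 1\<rparr>"

lemma monoid_M2: "monoid M2"
  by (rule monoidI) (simp_all add: M2_def matrix_mul_assoc)

definition mat2 :: "maxplus \<Rightarrow> maxplus \<Rightarrow> maxplus \<Rightarrow> maxplus \<Rightarrow> maxplus^2^2" where
  "mat2 a b c d = vector [vector [a, b], vector [c, d]]"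

lemma one_M2: "\<one>\<^bsub>M2\<^esub> = mat2 (Fin 0) NegInf NegInf (Fin 0)"
  by (simp add: M2_def mat2_def mat_def vec_eq_iff forall_2 one_maxplus_def zero_maxplus_def)

definition X :: "maxplus \<Rightarrow> maxplus^2^2" where
  "X i = mat2 i (Fin 0) (Fin 0) NegInf"

definition Y :: "maxplus^2^2" where
  "Y = mat2 (Fin 1) NegInf NegInf (Fin 0)"

definition Z :: "maxplus^2^2" where
  "Z = mat2 NegInf NegInf NegInf (Fin 0)"

definition W :: "nat \<Rightarrow> nat \<Rightarrow> maxplus^2^2" where
  "W j k = mat2 (Fin 0) (Fin j) (Fin k) (Fin 0)"

text \<open>The intersection of all submonoids of \<open>G\<close> containing \<open>S\<close>; meaningful for \<open>S \<subseteq> carrier G\<close>.\<close>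

definition generated_submonoid :: "('a, 'b) monoid_scheme \<Rightarrow> 'a set \<Rightarrow> 'a set" where
  "generated_submonoid G S = (\<lambda>H. submonoid H G) hull S"

end

theory Submission
  imports Defs
begin

text \<open>
  The generator \<open>X NegInf\<close> is the permutation matrix that exchanges the two coordinates, so a
  submonoid containing the generators is closed under exchanging rows and under exchanging columns.
  Together with \<open>Y\<close> and \<open>Z\<close> the exchange yields all diagonal matrices, so rows and columns may
  also be scaled. Scaling \<open>X a\<close> gives every matrix with minus infinity in the lower right corner,
  hence, up to exchanges, every matrix with an entry minus infinity.

  Let now the entries \<open>a, b, c, d\<close> be finite. Exchanging columns swaps the two diagonals, so one
  may assume \<open>b + c \<le> a + d\<close>. If \<open>a\<close> or \<open>d\<close> is at most \<open>b + c\<close>, the matrix is a product of two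
  triangular matrices, which have an entry minus infinity
  (\<open>heavy_diagonal_small_corner_mem\<close>). Otherwise \<open>a\<close> and \<open>d\<close> both exceed \<open>b + c\<close>; the
  matrix is then, after exchanging the columns, a row-scaled \<open>W j k\<close>
  (\<open>dominant_antidiagonal_mem\<close>).
\<close>

lemma mat2_mult:
  "mat2 a b c d ** mat2 a' b' c' d' =
     mat2 (a * a' + b * c') (a * b' + b * d') (c * a' + d * c') (c * b' + d * d')"
  by (simp add: mat2_def matrix_matrix_mult_def vec_eq_iff forall_2 sum_2)

lemma mat2_surj: obtains a b c d where "A = mat2 a b c d"
proof
  show "A = mat2 (A $ 1 $ 1) (A $ 1 $ 2) (A $ 2 $ 1) (A $ 2 $ 2)"
    by (simp add: mat2_def vec_eq_iff forall_2)
qed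

lemma maxplus_add_simps [simp]:
  "NegInf + x = x" "x + NegInf = x" "Fin m + Fin n = Fin (max m n)"
  by (cases x; simp add: plus_maxplus_def max_def)+

lemma maxplus_mult_simps [simp]:
  "x * NegInf = NegInf" "Fin 0 * x = x" "x * Fin 0 = x"
  by (cases x; simp)+

text \<open>
  A fixed submonoid containing the generators is enough to work in: the generated submonoid is the
  intersection of all of them.
\<close>

locale submonoid_with_generators =
  fixes H :: "(maxplus^2^2) set"
  assumes submonoid: "submonoid H M2"
    and generators: "range X \<union> {Y, Z} \<union> {W j k | j k. 0 < j \<and> j \<le> k} \<subseteq> H"
begin

lemma mult_mem: "A \<in> H \<Longrightarrow> B \<in> H \<Longrightarrow> A ** B \<in> H"
  using submonoid.m_closed[OF submonoid] by (simp add: M2_def)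

lemma one_mem: "mat2 (Fin 0) NegInf NegInf (Fin 0) \<in> H"
  using submonoid.one_closed[OF submonoid] by (simp add: one_M2)

lemma X_mem: "mat2 i (Fin 0) (Fin 0) NegInf \<in> H"
  using generators by (auto simp: X_def)

lemma swap_columns_mem: "mat2 b a d c \<in> H \<Longrightarrow> mat2 a b c d \<in> H"
  using mult_mem[OF _ X_mem[of NegInf]] by (fastforce simp: mat2_mult)

lemma swap_rows_mem: "mat2 c d a b \<in> H \<Longrightarrow> mat2 a b c d \<in> H"
  using mult_mem[OF X_mem[of NegInf]] by (fastforce simp: mat2_mult)

lemma swap_both_mem: "mat2 d c b a \<in> H \<Longrightarrow> mat2 a b c d \<in> H"
  by (rule swap_columns_mem, rule swap_rows_mem)

lemma diagonal_one_mem: "mat2 x NegInf NegInf (Fin 0) \<in> H"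
proof (cases x)
  case NegInf
  then show ?thesis using generators by (auto simp: Z_def)
next
  case (Fin n)
  have "mat2 (Fin n) NegInf NegInf (Fin 0) \<in> H"
  proof (induction n)
    case 0
    show ?case by (rule one_mem)
  next
    case (Suc n)
    have "Y \<in> H" using generators by auto
    from mult_mem[OF this Suc.IH] show ?case by (simp add: Y_def mat2_mult)
  qed
  then show ?thesis by (simp add: Fin)
qed

lemma one_diagonal_mem: "mat2 (Fin 0) NegInf NegInf x \<in> H"
  by (rule swap_both_mem) (rule diagonal_one_mem)

lemma diagonal_mem: "mat2 x NegInf NegInf y \<in> H"
  using mult_mem[OF diagonal_one_mem[of x] one_diagonal_mem[of y]] by (simp add: mat2_mult)

text \<open>
  The corner opposite to minus infinity is already free in \<open>X a\<close>; scaling the second row and the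
  second column leaves it alone and turns the two entries \<open>Fin 0\<close> into arbitrary ones.
\<close>

lemma lower_right_NegInf_mem: "mat2 a b c NegInf \<in> H"
  using mult_mem[OF mult_mem[OF one_diagonal_mem[of c] X_mem[of a]] one_diagonal_mem[of b]]
  by (simp add: mat2_mult)

lemma NegInf_entry_mem:
  assumes "a = NegInf \<or> b = NegInf \<or> c = NegInf \<or> d = NegInf"
  shows "mat2 a b c d \<in> H"
  using assms
  by (auto intro: lower_right_NegInf_mem
      swap_both_mem[OF lower_right_NegInf_mem]
      swap_rows_mem[OF lower_right_NegInf_mem] swap_columns_mem[OF lower_right_NegInf_mem])

text \<open>
  An upper triangular matrix with right column \<open>q, r\<close> times a lower triangular one with bottom row
  \<open>t, u\<close> has the entries \<open>q + u\<close>, \<open>r + t\<close>, \<open>r + u\<close> off the upper left corner. These are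
  \<open>b, c, d\<close> for suitable natural numbers precisely when \<open>d\<close> splits as \<open>r + u\<close> with \<open>u \<le> b\<close> and
  \<open>r \<le> c\<close>, that is, when \<open>d \<le> b + c\<close>. The corner is then the maximum of \<open>b + c - d\<close> and a
  free entry, so it can be any \<open>a\<close> with \<open>b + c \<le> a + d\<close>.
\<close>

lemma heavy_diagonal_small_corner_mem:
  assumes "b + c \<le> a + d" and "d \<le> b + c"
  shows "mat2 (Fin a) (Fin b) (Fin c) (Fin d) \<in> H"
proof -
  define u where "u = min b d"
  define r where "r = d - u"
  define q where "q = b - u"
  define t where "t = c - r"
  have eqs: "q + u = b" "r + t = c" "r + u = d" "max a (q + t) = a"
    using assms by (auto simp: u_def r_def q_def t_def)
  have "mat2 (Fin a) (Fin q) NegInf (Fin r) \<in> H" "mat2 (Fin 0) NegInf (Fin t) (Fin u) \<in> H"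
    by (simp_all add: NegInf_entry_mem)
  from mult_mem[OF this] show ?thesis by (simp add: mat2_mult eqs)
qed

text \<open>
  Conjugation by the exchange turns \<open>W j k\<close> into \<open>W k j\<close>, so the order of the parameters
  of the generators is no restriction.
\<close>

lemma W_mem:
  assumes "0 < j" and "0 < k"
  shows "mat2 (Fin 0) (Fin j) (Fin k) (Fin 0) \<in> H"
proof (cases "j \<le> k")
  case True
  with assms generators have "W j k \<in> H" by blast
  then show ?thesis by (simp add: W_def)
next
  case False
  then have "k \<le> j" by simp
  with assms generators have "W k j \<in> H" by blast
  then show ?thesis by (simp add: W_def swap_both_mem[of "Fin 0" "Fin k"])
qed

lemma dominant_antidiagonal_mem:
  assumes "a < b" and "d < c"
  shows "mat2 (Fin a) (Fin b) (Fin c) (Fin d) \<in> H"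
proof -
  have "mat2 (Fin 0) (Fin (b - a)) (Fin (c - d)) (Fin 0) \<in> H"
    using assms by (intro W_mem) simp_all
  from mult_mem[OF diagonal_mem[of "Fin a" "Fin d"] this] show ?thesis
    using assms by (simp add: mat2_mult)
qed

lemma heavy_diagonal_mem:
  assumes "b + c \<le> a + d"
  shows "mat2 (Fin a) (Fin b) (Fin c) (Fin d) \<in> H"
proof -
  consider "d \<le> b + c" | "a \<le> b + c" | "b < a" "c < d" by linarith
  then show ?thesis
  proof cases
    case 1
    with assms show ?thesis by (rule heavy_diagonal_small_corner_mem)
  next
    case 2
    with assms show ?thesis
      by (simp add: swap_both_mem[OF heavy_diagonal_small_corner_mem] add.commute)
  next
    case 3
    then show ?thesis
      by (rule swap_columns_mem[OF dominant_antidiagonal_mem])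
  qed
qed

lemma finite_entries_mem: "mat2 (Fin a) (Fin b) (Fin c) (Fin d) \<in> H"
proof (cases "b + c \<le> a + d")
  case True
  then show ?thesis by (rule heavy_diagonal_mem)
next
  case False
  then show ?thesis by (simp add: swap_columns_mem[OF heavy_diagonal_mem])
qed

lemma all_mem: "A \<in> H"
proof -
  obtain a b c d where A: "A = mat2 a b c d" by (rule mat2_surj)
  show ?thesis
    unfolding A
    by (cases a; cases b; cases c; cases d) (simp_all add: NegInf_entry_mem finite_entries_mem)
qed

end

theorem theorem2p1:
  shows "generated_submonoid M2 (range X \<union> {Y, Z} \<union> {W j k | j k. 0 < j \<and> j \<le> k}) = carrier M2"
proof -
  have "H = UNIV"
    if "submonoid H M2" "range X \<union> {Y, Z} \<union> {W j k | j k. 0 < j \<and> j \<le> k} \<subseteq> H" for H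
    using submonoid_with_generators.all_mem[OF submonoid_with_generators.intro[OF that]] by blast
  then show ?thesis
    unfolding generated_submonoid_def hull_def by (auto simp: M2_def)
qed

end
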